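(* There exist six finite-dimensional complex vector spaces $A_1,A_2,B_1,B_2,C_1,C_2$ and a tensor $T\in(A_1\oplus A_2)\otimes(B_1\oplus B_2)\otimes(C_1\oplus C_2)$ such that $$\mathbf{R}(T)<\min\mathbf{R}\Bigl(T_{111}\bmod\bigl(T_{211}(A_2^* ),T_{121}(B_2^* ),T_{112}(C_2^* )\bigr)\Bigr)+\min\mathbf{R}\Bigl(T_{222}\bmod\bigl(T_{122}(A_1^* ),T_{212}(B_1^* ),T_{221}(C_1^* )\bigr)\Bigr),$$ where, for $i,j,k\in\{1,2\}$, $T_{ijk}=T|_{A_i^*\otimes B_j^*\otimes C_k^*}\in A_i\otimes B_j\otimes C_k$ denotes the $(i,j,k)$-block of $T$.
   Context: All vector spaces are finite-dimensional over $\mathbb{C}$. $\mathbf{R}(T)$ denotes tensor rank: the minimum number of simple tensors $a\otimes b\otimes c$ summing to $T$. For $S\in A\otimes B\otimes C$, $S(A^* )\subset B\otimes C$ denotes the image of the flattening map $A^*\to B\otimes C$ obtained by contracting $S$ in the first factor; similarly $S(B^* )\subset A\otimes C$ and $S(C^* )\subset A\otimes B$. For $S\in A\otimes B\otimes C$ and subspaces $W_A\subset B\otimes C$, $W_B\subset A\otimes C$, $W_C\subset A\otimes B$, the set $S\bmod(W_A,W_B,W_C)$ of modifications of $S$ consists of all tensors $S+\sum_i a_i\otimes u_i+\sum_j b_j\otimes v_j+\sum_k w_k\otimes c_k$ (finite sums) with $a_i\in A$, $u_i\in W_A$, $b_j\in B$, $v_j\in W_B$, $c_k\in C$, $w_k\in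 W_C$, all summands being reordered to lie in $A\otimes B\otimes C$. $\min\mathbf{R}(S\bmod(W_A,W_B,W_C))$ is the smallest rank of an element of this set. *)

theory Defs
  imports Complex_Main
begin

text \<open>
  Vector spaces are coordinate spaces: the space with basis indexed by a finite set \<open>I\<close> is the
  set of functions to the complex numbers vanishing outside \<open>I\<close>, and its dual is identified
  with the same space via the dual basis. The tensor product of the spaces over \<open>I\<close>, \<open>J\<close>, \<open>K\<close>
  is the space over \<open>I \<times> J \<times> K\<close> (curried), and the direct sum of the spaces over \<open>I\<^sub>1\<close> and
  \<open>I\<^sub>2\<close> is the space over the disjoint union \<open>I\<^sub>1 <+> I\<^sub>2\<close>.
\<close>

definition vec_space :: "'i set \<Rightarrow> ('i \<Rightarrow> complex) set" where
  "vec_space I = {a. \<forall>i. i \<notin> I \<longrightarrow> a i = 0}"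

definition tensor_space ::
    "'i set \<Rightarrow> 'j set \<Rightarrow> 'k set \<Rightarrow> ('i \<Rightarrow> 'j \<Rightarrow> 'k \<Rightarrow> complex) set" where
  "tensor_space I J K = {T. \<forall>i j k. (i, j, k) \<notin> I \<times> J \<times> K \<longrightarrow> T i j k = 0}"

text \<open>
  The minimum below is attained when \<open>I\<close>, \<open>J\<close>, \<open>K\<close> are finite and
  \<open>T \<in> tensor_space I J K\<close>; otherwise the value is not meaningful.
\<close>

definition tensor_rank ::
    "'i set \<Rightarrow> 'j set \<Rightarrow> 'k set \<Rightarrow> ('i \<Rightarrow> 'j \<Rightarrow> 'k \<Rightarrow> complex) \<Rightarrow> nat" where
  "tensor_rank I J K T =
    (LEAST r. \<exists>a b c.
       (\<forall>l<r. a l \<in> vec_space I \<and> b l \<in> vec_space J \<and> c l \<in> vec_space K) \<and>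
       T = (\<lambda>i j k. \<Sum>l<r. a l i * b l j * c l k))"

text \<open>Images of the three flattening maps \<open>A\<^sup>* \<rightarrow> B \<otimes> C\<close>, \<open>B\<^sup>* \<rightarrow> A \<otimes> C\<close>, \<open>C\<^sup>* \<rightarrow> A \<otimes> B\<close>.\<close>

definition flat_A :: "'i set \<Rightarrow> ('i \<Rightarrow> 'j \<Rightarrow> 'k \<Rightarrow> complex) \<Rightarrow> ('j \<Rightarrow> 'k \<Rightarrow> complex) set" where
  "flat_A I S = (\<lambda>\<alpha> j k. \<Sum>i\<in>I. \<alpha> i * S i j k) ` vec_space I"

definition flat_B :: "'j set \<Rightarrow> ('i \<Rightarrow> 'j \<Rightarrow> 'k \<Rightarrow> complex) \<Rightarrow> ('i \<Rightarrow> 'k \<Rightarrow> complex) set" where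
  "flat_B J S = (\<lambda>\<beta> i k. \<Sum>j\<in>J. \<beta> j * S i j k) ` vec_space J"

definition flat_C :: "'k set \<Rightarrow> ('i \<Rightarrow> 'j \<Rightarrow> 'k \<Rightarrow> complex) \<Rightarrow> ('i \<Rightarrow> 'j \<Rightarrow> complex) set" where
  "flat_C K S = (\<lambda>\<gamma> i j. \<Sum>k\<in>K. \<gamma> k * S i j k) ` vec_space K"

definition modifications ::
    "'i set \<Rightarrow> 'j set \<Rightarrow> 'k set \<Rightarrow> ('i \<Rightarrow> 'j \<Rightarrow> 'k \<Rightarrow> complex) \<Rightarrow>
     ('j \<Rightarrow> 'k \<Rightarrow> complex) set \<Rightarrow> ('i \<Rightarrow> 'k \<Rightarrow> complex) set \<Rightarrow> ('i \<Rightarrow> 'j \<Rightarrow> complex) set \<Rightarrow>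
     ('i \<Rightarrow> 'j \<Rightarrow> 'k \<Rightarrow> complex) set" where
  "modifications I J K S W\<^sub>A W\<^sub>B W\<^sub>C =
    {S'. \<exists>(p::nat) (q::nat) (r::nat) a u b v w c.
       (\<forall>l<p. a l \<in> vec_space I \<and> u l \<in> W\<^sub>A) \<and>
       (\<forall>l<q. b l \<in> vec_space J \<and> v l \<in> W\<^sub>B) \<and>
       (\<forall>l<r. w l \<in> W\<^sub>C \<and> c l \<in> vec_space K) \<and>
       S' = (\<lambda>i j k. S i j k + (\<Sum>l<p. a l i * u l j k)
                             + (\<Sum>l<q. b l j * v l i k)
                             + (\<Sum>l<r. w l i j * c l k))}"

definition min_rank_mod ::
    "'i set \<Rightarrow> 'j set \<Rightarrow> 'k set \<Rightarrow> ('i \<Rightarrow> 'j \<Rightarrow> 'k \<Rightarrow> complex) \<Rightarrow>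
     ('j \<Rightarrow> 'k \<Rightarrow> complex) set \<Rightarrow> ('i \<Rightarrow> 'k \<Rightarrow> complex) set \<Rightarrow> ('i \<Rightarrow> 'j \<Rightarrow> complex) set \<Rightarrow> nat" where
  "min_rank_mod I J K S W\<^sub>A W\<^sub>B W\<^sub>C =
    (LEAST r. \<exists>S' \<in> modifications I J K S W\<^sub>A W\<^sub>B W\<^sub>C. tensor_rank I J K S' = r)"

text \<open>
  With \<open>f\<close>, \<open>g\<close>, \<open>h\<close> each one of \<open>Inl\<close> (first summand) and \<open>Inr\<close> (second summand), this is the
  corresponding block of a tensor in a product of direct sums; for instance the block
  \<open>T\<^sub>2\<^sub>1\<^sub>1\<close> is \<open>block T Inr Inl Inl\<close>.
\<close>

definition block ::
    "('x \<Rightarrow> 'y \<Rightarrow> 'z \<Rightarrow> complex) \<Rightarrow> ('i \<Rightarrow> 'x) \<Rightarrow> ('j \<Rightarrow> 'y) \<Rightarrow> ('k \<Rightarrow> 'z) \<Rightarrow>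
     'i \<Rightarrow> 'j \<Rightarrow> 'k \<Rightarrow> complex" where
  "block T f g h = (\<lambda>i j k. T (f i) (g j) (h k))"

end

theory Submission
  imports Defs "HOL-Analysis.Analysis"
begin

text \<open>
  The tensor is \<open>T = \<Sum>\<^bsub>h,j<k\<^esub> (f\<^bsub>hj\<^esub> \<oplus> g\<^bsub>hj\<^esub>) \<otimes> (e\<^sub>h \<oplus> e\<^sub>j) \<otimes> (e\<^sub>j \<oplus> e\<^sub>h)\<close> with generic vectors
  \<open>f\<^bsub>hj\<^esub>\<close>, \<open>g\<^bsub>hj\<^esub>\<close> in dimension \<open>n\<close>; its rank is at most \<open>k\<^sup>2\<close>. The block \<open>T\<^sub>1\<^sub>1\<^sub>1\<close> has the entries of the
  \<open>f\<^bsub>hj\<^esub>\<close>, while \<open>T\<^sub>1\<^sub>2\<^sub>1\<close> and \<open>T\<^sub>1\<^sub>1\<^sub>2\<close> depend only on the sums \<open>v\<^sub>j = \<Sum>\<^sub>h f\<^bsub>hj\<^esub>\<close> and \<open>u\<^sub>h = \<Sum>\<^sub>j f\<^bsub>hj\<^esub>\<close>. So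
  a modification of \<open>T\<^sub>1\<^sub>1\<^sub>1\<close> of rank at most \<open>r\<close> gives (\<open>reducible\<close> below)
  \<open>f\<^bsub>hj\<^esub> + X g\<^bsub>hj\<^esub> + Y\<^bsub>hj\<^esub> v\<^sub>j + Z\<^bsub>jh\<^esub> u\<^sub>h = \<Sum>\<^bsub>l<r\<^esub> q\<^bsub>lh\<^esub> w\<^bsub>lj\<^esub> p\<^sub>l\<close>. With \<open>u\<close> and \<open>v\<close> taken as further free
  parameters, this writes \<open>f\<close> as a polynomial in \<open>g\<close> and
  \<open>n\<^sup>2 + 2 k\<^sup>2 + 2 n k + r (n + 2 k)\<close> parameters. If that number is less than \<open>n k\<^sup>2\<close>, then such \<open>(f, g)\<close>
  form a null set. The block \<open>T\<^sub>2\<^sub>2\<^sub>2\<close> is symmetric. For \<open>n = 128\<close>, \<open>k = 32\<close>, \<open>r = 512\<close> the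
  count is \<open>124928 < 131072\<close>, and the ranks are \<open>k\<^sup>2 = 1024 < 2 (r + 1)\<close>.
\<close>

section \<open>Decompositions into simple tensors\<close>

definition has_decomposition ::
    "'i set \<Rightarrow> 'j set \<Rightarrow> 'k set \<Rightarrow> nat \<Rightarrow> ('i \<Rightarrow> 'j \<Rightarrow> 'k \<Rightarrow> complex) \<Rightarrow> bool" where
  "has_decomposition I J K r T \<longleftrightarrow>
    (\<exists>a b c. (\<forall>l<r. a l \<in> vec_space I \<and> b l \<in> vec_space J \<and> c l \<in> vec_space K) \<and>
       T = (\<lambda>i j k. \<Sum>l<r. a l i * b l j * c l k))"

lemma tensor_rank_eq_Least: "tensor_rank I J K T = (LEAST r. has_decomposition I J K r T)"
  unfolding tensor_rank_def has_decomposition_def ..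

lemma has_decomposition_mono:
  assumes "has_decomposition I J K r T" and "r \<le> s"
  shows "has_decomposition I J K s T"
proof -
  obtain a b c where abc: "\<forall>l<r. a l \<in> vec_space I \<and> b l \<in> vec_space J \<and> c l \<in> vec_space K"
    and T: "T = (\<lambda>i j k. \<Sum>l<r. a l i * b l j * c l k)"
    using assms(1) unfolding has_decomposition_def by blast
  define a' where "a' = (\<lambda>l. if l < r then a l else (\<lambda>_. 0))"
  define b' where "b' = (\<lambda>l. if l < r then b l else (\<lambda>_. 0))"
  define c' where "c' = (\<lambda>l. if l < r then c l else (\<lambda>_. 0))"
  have "T = (\<lambda>i j k. \<Sum>l<s. a' l i * b' l j * c' l k)"
    unfolding T using assms(2)
    by (intro ext sum.mono_neutral_cong_left) (auto simp: a'_def b'_def c'_def)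
  moreover have "\<forall>l<s. a' l \<in> vec_space I \<and> b' l \<in> vec_space J \<and> c' l \<in> vec_space K"
    using abc by (auto simp: a'_def b'_def c'_def vec_space_def)
  ultimately show ?thesis
    unfolding has_decomposition_def by blast
qed

lemma has_decomposition_family:
  assumes "finite L"
    and "\<And>l. l \<in> L \<Longrightarrow> a l \<in> vec_space I"
    and "\<And>l. l \<in> L \<Longrightarrow> b l \<in> vec_space J"
    and "\<And>l. l \<in> L \<Longrightarrow> c l \<in> vec_space K"
  shows "has_decomposition I J K (card L) (\<lambda>i j k. \<Sum>l\<in>L. a l i * b l j * c l k)"
proof -
  obtain \<phi> where \<phi>: "bij_betw \<phi> {..<card L} L"
    using ex_bij_betw_nat_finite[OF assms(1)] by (auto simp: lessThan_atLeast0)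
  have "(\<lambda>i j k. \<Sum>l\<in>L. a l i * b l j * c l k)
      = (\<lambda>i j k. \<Sum>l<card L. a (\<phi> l) i * b (\<phi> l) j * c (\<phi> l) k)"
    by (intro ext sum.reindex_bij_betw[OF \<phi>, symmetric])
  moreover have "\<phi> l \<in> L" if "l < card L" for l
    using \<phi> that by (auto simp: bij_betw_def)
  ultimately show ?thesis
    unfolding has_decomposition_def using assms(2-4)
    by (intro exI[of _ "\<lambda>l. a (\<phi> l)"] exI[of _ "\<lambda>l. b (\<phi> l)"] exI[of _ "\<lambda>l. c (\<phi> l)"]) auto
qed

text \<open>Expands T as the sum of e_i \<otimes> e_j \<otimes> T(i, j, -) over I \<times> J. Hence
  the \<open>LEAST\<close> in \<open>tensor_rank\<close> is attained, and the rank of such a T is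
  the length of an actual decomposition.\<close>

lemma has_decomposition_exists:
  assumes "T \<in> tensor_space I J K" and "finite I" and "finite J"
  shows "\<exists>r. has_decomposition I J K r T"
proof -
  have "T i j k = (\<Sum>l\<in>I \<times> J. of_bool (i = fst l) * of_bool (j = snd l) * T (fst l) (snd l) k)"
    for i j k
  proof -
    have "(\<Sum>l\<in>I \<times> J. of_bool (i = fst l) * of_bool (j = snd l) * T (fst l) (snd l) k)
        = (\<Sum>l\<in>I \<times> J. if l = (i, j) then T i j k else 0)"
      by (intro sum.cong) auto
    also have "\<dots> = T i j k"
      using assms by (auto simp: tensor_space_def)
    finally show ?thesis ..
  qed
  then have "T = (\<lambda>i j k. \<Sum>l\<in>I \<times> J. of_bool (i = fst l) * of_bool (j = snd l) * T (fst l) (snd l) k)"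
    by blast
  moreover have "has_decomposition I J K (card (I \<times> J)) \<dots>"
    using assms by (intro has_decomposition_family) (auto simp: vec_space_def tensor_space_def)
  ultimately show ?thesis by auto
qed

lemma tensor_rank_le: "has_decomposition I J K r T \<Longrightarrow> tensor_rank I J K T \<le> r"
  unfolding tensor_rank_eq_Least by (rule Least_le)

section \<open>Modifications as matrices, and lower bounds for their minimal rank\<close>

lemma modification_matrices:
  assumes "S' \<in> modifications I J K S (flat_A I\<^sub>2 P) (flat_B J\<^sub>2 Q) (flat_C K\<^sub>2 R)"
  obtains X Y Z where
    "\<And>i i'. i \<notin> I \<Longrightarrow> X i i' = 0" "\<And>j j'. j \<notin> J \<Longrightarrow> Y j j' = 0" "\<And>k k'. k \<notin> K \<Longrightarrow> Z k k' = 0"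
    "S' = (\<lambda>i j k. S i j k + (\<Sum>i'\<in>I\<^sub>2. X i i' * P i' j k) + (\<Sum>j'\<in>J\<^sub>2. Y j j' * Q i j' k)
                           + (\<Sum>k'\<in>K\<^sub>2. Z k k' * R i j k'))"
proof -
  obtain p q r :: nat and a u b v w c where
    a: "\<forall>l<p. a l \<in> vec_space I \<and> u l \<in> flat_A I\<^sub>2 P"
    and b: "\<forall>l<q. b l \<in> vec_space J \<and> v l \<in> flat_B J\<^sub>2 Q"
    and c: "\<forall>l<r. w l \<in> flat_C K\<^sub>2 R \<and> c l \<in> vec_space K"
    and S': "S' = (\<lambda>i j k. S i j k + (\<Sum>l<p. a l i * u l j k) + (\<Sum>l<q. b l j * v l i k)
                                   + (\<Sum>l<r. w l i j * c l k))"
    using assms unfolding modifications_def by blast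
  have "\<forall>l. \<exists>\<alpha>. l < p \<longrightarrow> u l = (\<lambda>j k. \<Sum>i\<in>I\<^sub>2. \<alpha> i * P i j k)"
    using a unfolding flat_A_def by blast
  then obtain \<alpha> where \<alpha>: "\<And>l. l < p \<Longrightarrow> u l = (\<lambda>j k. \<Sum>i\<in>I\<^sub>2. \<alpha> l i * P i j k)"
    by metis
  have "\<forall>l. \<exists>\<beta>. l < q \<longrightarrow> v l = (\<lambda>i k. \<Sum>j\<in>J\<^sub>2. \<beta> j * Q i j k)"
    using b unfolding flat_B_def by blast
  then obtain \<beta> where \<beta>: "\<And>l. l < q \<Longrightarrow> v l = (\<lambda>i k. \<Sum>j\<in>J\<^sub>2. \<beta> l j * Q i j k)"
    by metis
  have "\<forall>l. \<exists>\<gamma>. l < r \<longrightarrow> w l = (\<lambda>i j. \<Sum>k\<in>K\<^sub>2. \<gamma> k * R i j k)"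
    using c unfolding flat_C_def by blast
  then obtain \<gamma> where \<gamma>: "\<And>l. l < r \<Longrightarrow> w l = (\<lambda>i j. \<Sum>k\<in>K\<^sub>2. \<gamma> l k * R i j k)"
    by metis
  \<comment> \<open>Summing the products of a vector and a covector over l gives one matrix. So X,
    Y, Z describe the modification however large p, q, r are; the dimension count rests on
    this.\<close>
  have "(\<Sum>l<p. a l i * u l j k) = (\<Sum>i'\<in>I\<^sub>2. (\<Sum>l<p. a l i * \<alpha> l i') * P i' j k)" for i j k
    by (simp add: \<alpha> sum_distrib_left sum_distrib_right mult.assoc sum.swap[of _ "{..<p}"])
  moreover have "(\<Sum>l<q. b l j * v l i k) = (\<Sum>j'\<in>J\<^sub>2. (\<Sum>l<q. b l j * \<beta> l j') * Q i j' k)" for i j k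
    by (simp add: \<beta> sum_distrib_left sum_distrib_right mult.assoc sum.swap[of _ "{..<q}"])
  moreover have "(\<Sum>l<r. w l i j * c l k) = (\<Sum>k'\<in>K\<^sub>2. (\<Sum>l<r. c l k * \<gamma> l k') * R i j k')" for i j k
    by (simp add: \<gamma> sum_distrib_left sum_distrib_right mult_ac sum.swap[of _ "{..<r}"])
  ultimately have decomp: "S' = (\<lambda>i j k. S i j k + (\<Sum>i'\<in>I\<^sub>2. (\<Sum>l<p. a l i * \<alpha> l i') * P i' j k)
      + (\<Sum>j'\<in>J\<^sub>2. (\<Sum>l<q. b l j * \<beta> l j') * Q i j' k)
      + (\<Sum>k'\<in>K\<^sub>2. (\<Sum>l<r. c l k * \<gamma> l k') * R i j k'))"
    by (simp add: S')
  then show ?thesis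
    using a b c by (intro that[OF _ _ _ decomp]) (auto simp: vec_space_def)
qed

text \<open>A decomposition of a modification with at most r terms can be padded by zeros to exactly
  r terms, so excluding this one length for all matrices X, Y, Z suffices.\<close>

lemma min_rank_mod_gtI:
  assumes fin: "finite I" "finite J"
    and S: "S \<in> tensor_space I J K" and P: "P \<in> tensor_space I\<^sub>2 J K"
    and Q: "Q \<in> tensor_space I J\<^sub>2 K" and R: "R \<in> tensor_space I J K\<^sub>2"
    and no: "\<And>X Y Z. \<not> has_decomposition I J K r
      (\<lambda>i j k. S i j k + (\<Sum>i'\<in>I\<^sub>2. X i i' * P i' j k) + (\<Sum>j'\<in>J\<^sub>2. Y j j' * Q i j' k)
                       + (\<Sum>k'\<in>K\<^sub>2. Z k k' * R i j k'))"
  shows "r < min_rank_mod I J K S (flat_A I\<^sub>2 P) (flat_B J\<^sub>2 Q) (flat_C K\<^sub>2 R)"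
proof -
  let ?M = "modifications I J K S (flat_A I\<^sub>2 P) (flat_B J\<^sub>2 Q) (flat_C K\<^sub>2 R)"
  \<comment> \<open>The empty sums p = q = r = 0 show that the minimum is over a nonempty set, hence
    attained.\<close>
  have "S \<in> ?M"
    unfolding modifications_def by (rule CollectI, rule exI[of _ 0], rule exI[of _ 0], rule exI[of _ 0]) simp
  then have "\<exists>r. \<exists>S'\<in>?M. tensor_rank I J K S' = r"
    by blast
  from LeastI_ex[OF this] obtain S' where S': "S' \<in> ?M"
    and rank: "tensor_rank I J K S' = min_rank_mod I J K S (flat_A I\<^sub>2 P) (flat_B J\<^sub>2 Q) (flat_C K\<^sub>2 R)"
    unfolding min_rank_mod_def[symmetric] by (elim bexE)
  obtain X Y Z where
    XYZ: "\<And>i i'. i \<notin> I \<Longrightarrow> X i i' = 0" "\<And>j j'. j \<notin> J \<Longrightarrow> Y j j' = 0" "\<And>k k'. k \<notin> K \<Longrightarrow> Z k k' = 0"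
    and eq: "S' = (\<lambda>i j k. S i j k + (\<Sum>i'\<in>I\<^sub>2. X i i' * P i' j k) + (\<Sum>j'\<in>J\<^sub>2. Y j j' * Q i j' k)
                           + (\<Sum>k'\<in>K\<^sub>2. Z k k' * R i j k'))"
    by (rule modification_matrices[OF S']) (rule that)
  \<comment> \<open>The supports of X, Y, Z and of the blocks keep S' inside the tensor space, where
    its rank is attained.\<close>
  have "S' i j k = 0" if "(i, j, k) \<notin> I \<times> J \<times> K" for i j k
  proof -
    have "S i j k = 0" "X i i' * P i' j k = 0" "Y j j' * Q i j' k = 0" "Z k k' * R i j k' = 0"
      for i' j' k'
      using that S P Q R XYZ by (auto simp: tensor_space_def)
    then show ?thesis
      by (simp only: eq sum.neutral_const add_0_right)
  qed
  then have "S' \<in> tensor_space I J K"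
    by (simp add: tensor_space_def)
  then have "has_decomposition I J K (tensor_rank I J K S') S'"
    unfolding tensor_rank_eq_Least by (rule LeastI_ex[OF has_decomposition_exists[OF _ fin]])
  moreover have "\<not> has_decomposition I J K r S'"
    unfolding eq by (rule no)
  ultimately have "\<not> tensor_rank I J K S' \<le> r"
    using has_decomposition_mono by blast
  then show ?thesis
    using rank by simp
qed

section \<open>Generic pairs (f, g) are not reducible: a dimension count\<close>

lemma differentiable_vec_lambda:
  fixes f :: "'i::finite \<Rightarrow> 'a::real_normed_vector \<Rightarrow> 'b::euclidean_space"
  assumes "\<And>i. f i differentiable F"
  shows "(\<lambda>x. \<chi> i. f i x) differentiable F"
proof -
  have lin: "bounded_linear (axis i :: 'b \<Rightarrow> 'b ^ 'i)" for i
    unfolding linear_conv_bounded_linear[symmetric]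
    by (rule linearI) (auto simp: axis_def vec_eq_iff)
  have "(\<lambda>x. \<chi> i. f i x) = (\<lambda>x. \<Sum>i\<in>UNIV. axis i (f i x))"
    by (auto simp: vec_eq_iff axis_def fun_eq_iff if_distrib[of "\<lambda>a. a $ _"])
  moreover have "(\<lambda>x. axis i (f i x)) differentiable F" for i
    using assms[of i] bounded_linear.has_derivative[OF lin] unfolding differentiable_def by blast
  ultimately show ?thesis
    by (simp add: differentiable_sum)
qed

lemma differentiable_vec_nth:
  fixes f :: "'a::real_normed_vector \<Rightarrow> ('b::euclidean_space) ^ 'i::finite"
  assumes "f differentiable F"
  shows "(\<lambda>x. f x $ i) differentiable F"
  using assms bounded_linear.has_derivative[OF bounded_linear_vec_nth]
  unfolding differentiable_def by blast

lemma differentiable_fst: "f differentiable F \<Longrightarrow> (\<lambda>x. fst (f x)) differentiable F"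
  and differentiable_snd: "f differentiable F \<Longrightarrow> (\<lambda>x. snd (f x)) differentiable F"
  using has_derivative_fst has_derivative_snd unfolding differentiable_def by blast+

text \<open>Left of the equation stands an entry of a modified \<open>T_111\<close>. The blocks
  \<open>T_121\<close> and \<open>T_112\<close> are diagonal in their last two indices, so only one
  entry of Y and one of Z survive, each multiplied by a sum of entries of f.\<close>

definition reducible :: "nat \<Rightarrow> nat \<Rightarrow> nat \<Rightarrow> (nat \<Rightarrow> nat \<Rightarrow> nat \<Rightarrow> complex) \<Rightarrow>
    (nat \<Rightarrow> nat \<Rightarrow> nat \<Rightarrow> complex) \<Rightarrow> bool" where
  "reducible n k r f g \<longleftrightarrow> (\<exists>X Y Z p q w. \<forall>i<n. \<forall>h<k. \<forall>j<k.
     f i h j + (\<Sum>i'<n. X i i' * g i' h j) + Y h j * (\<Sum>h'<k. f i h' j) + Z j h * (\<Sum>j'<k. f i h j')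
     = (\<Sum>l<r. p l i * q l h * w l j))"

lemma negligible_reducible:
  fixes bad :: "((complex ^ 'k::finite ^ 'k ^ 'a::finite) \<times> (complex ^ 'k ^ 'k ^ 'a)) set"
  assumes card: "CARD('a)\<^sup>2 + 2 * CARD('k)\<^sup>2 + 2 * CARD('a) * CARD('k)
      + CARD('r::finite) * (CARD('a) + 2 * CARD('k)) < CARD('a) * CARD('k)\<^sup>2"
    and bad: "\<And>F G. (F, G) \<in> bad \<Longrightarrow>
      \<exists>(X :: complex ^ 'a ^ 'a) (Y :: complex ^ 'k ^ 'k) (Z :: complex ^ 'k ^ 'k)
        (p :: complex ^ 'a ^ 'r) (q :: complex ^ 'k ^ 'r) (w :: complex ^ 'k ^ 'r). \<forall>i h j.
        F $ i $ h $ j + (\<Sum>i'\<in>UNIV. X $ i $ i' * G $ i' $ h $ j)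
          + Y $ h $ j * (\<Sum>h'\<in>UNIV. F $ i $ h' $ j) + Z $ j $ h * (\<Sum>j'\<in>UNIV. F $ i $ h $ j')
        = (\<Sum>l\<in>UNIV. p $ l $ i * q $ l $ h * w $ l $ j)"
  shows "negligible bad"
proof -
  \<comment> \<open>The defining equation solved for F, with the sums V and U of entries of F
    replaced by free parameters. G is copied to the output, so its dimension cancels, and
    \<open>card\<close> compares the remaining complex parameters with the dimension of F.\<close>
  define \<Phi> :: "(complex ^ 'a ^ 'a) \<times> (complex ^ 'k ^ 'k) \<times> (complex ^ 'k ^ 'k) \<times>
      (complex ^ 'k ^ 'a) \<times> (complex ^ 'k ^ 'a) \<times>
      (complex ^ 'a ^ 'r) \<times> (complex ^ 'k ^ 'r) \<times> (complex ^ 'k ^ 'r) \<times> (complex ^ 'k ^ 'k ^ 'a) \<Rightarrow> _"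
    where "\<Phi> = (\<lambda>(X, Y, Z, V, U, p, q, w, G).
      (\<chi> i h j. (\<Sum>l\<in>UNIV. p $ l $ i * q $ l $ h * w $ l $ j)
        - (\<Sum>i'\<in>UNIV. X $ i $ i' * G $ i' $ h $ j) - Y $ h $ j * V $ i $ j - Z $ j $ h * U $ i $ h, G))"
  have "\<Phi> differentiable_on UNIV"
    unfolding \<Phi>_def case_prod_beta differentiable_on_def
    by (intro ballI differentiable_Pair differentiable_vec_lambda differentiable_diff
        differentiable_sum differentiable_mult differentiable_vec_nth differentiable_fst
        differentiable_snd differentiable_ident finite)
  moreover have "bad \<subseteq> range \<Phi>"
  proof safe
    fix F G assume "(F, G) \<in> bad"
    then obtain X Y Z and p :: "complex ^ 'a ^ 'r" and q w :: "complex ^ 'k ^ 'r" where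
      eq: "\<forall>i h j. F $ i $ h $ j + (\<Sum>i'\<in>UNIV. X $ i $ i' * G $ i' $ h $ j)
          + Y $ h $ j * (\<Sum>h'\<in>UNIV. F $ i $ h' $ j) + Z $ j $ h * (\<Sum>j'\<in>UNIV. F $ i $ h $ j')
        = (\<Sum>l\<in>UNIV. p $ l $ i * q $ l $ h * w $ l $ j)"
      using bad by blast
    \<comment> \<open>V and U take the values they replaced, so every bad pair lies in the
      image.\<close>
    have "(F, G) = \<Phi> (X, Y, Z, \<chi> i j. \<Sum>h'\<in>UNIV. F $ i $ h' $ j, \<chi> i h. \<Sum>j'\<in>UNIV. F $ i $ h $ j',
        p, q, w, G)"
      unfolding \<Phi>_def by (simp add: vec_eq_iff eq[rule_format, symmetric])
    then show "(F, G) \<in> range \<Phi>"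
      by blast
  qed
  ultimately show ?thesis
    using card negligible_differentiable_image_lowdim[of \<Phi> UNIV] negligible_subset
    by (simp add: power2_eq_square algebra_simps)
qed

text \<open>One pair must serve both diagonal blocks. The second condition is the first one after
  exchanging f and g and transposing h and j. This is a linear map \<sigma>, so both exceptional
  sets are null and do not cover the space.\<close>

lemma generic_irreducible:
  assumes card: "CARD('a::finite)\<^sup>2 + 2 * CARD('k::finite)\<^sup>2 + 2 * CARD('a) * CARD('k)
      + CARD('r::finite) * (CARD('a) + 2 * CARD('k)) < CARD('a) * CARD('k)\<^sup>2"
  shows "\<exists>f g. \<not> reducible CARD('a) CARD('k) CARD('r) f g
    \<and> \<not> reducible CARD('a) CARD('k) CARD('r) (\<lambda>i h j. g i j h) (\<lambda>i h j. f i j h)"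
proof -
  have "\<exists>e. bij_betw e {..<CARD('a)} (UNIV :: 'a set)" "\<exists>e. bij_betw e {..<CARD('k)} (UNIV :: 'k set)"
    "\<exists>e. bij_betw e {..<CARD('r)} (UNIV :: 'r set)"
    using ex_bij_betw_nat_finite[OF finite] by (auto simp: lessThan_atLeast0)
  then obtain eA eK eR where eA: "bij_betw eA {..<CARD('a)} (UNIV :: 'a set)"
    and eK: "bij_betw eK {..<CARD('k)} (UNIV :: 'k set)"
    and eR: "bij_betw eR {..<CARD('r)} (UNIV :: 'r set)"
    by blast
  define dA where "dA = the_inv_into {..<CARD('a)} eA"
  define dK where "dK = the_inv_into {..<CARD('k)} eK"
  define dR where "dR = the_inv_into {..<CARD('r)} eR"
  have d: "bij_betw dA UNIV {..<CARD('a)}" "bij_betw dK UNIV {..<CARD('k)}" "bij_betw dR UNIV {..<CARD('r)}"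
    unfolding dA_def dK_def dR_def using eA eK eR by (auto intro: bij_betw_the_inv_into)
  have lt: "dA i < CARD('a)" "dK h < CARD('k)" for i h
    using d by (auto simp: bij_betw_def)
  have ed: "eA (dA i) = i" "eK (dK h) = h" for i h
    using f_the_inv_into_f_bij_betw[OF eA] f_the_inv_into_f_bij_betw[OF eK]
    by (simp_all add: dA_def dK_def)
  \<comment> \<open>Passes from finite index types, where Lebesgue measure lives, to natural number
    indices; \<open>dA\<close>, \<open>dK\<close>, \<open>dR\<close> lead back.\<close>
  define fn :: "complex ^ 'k ^ 'k ^ 'a \<Rightarrow> nat \<Rightarrow> nat \<Rightarrow> nat \<Rightarrow> complex"
    where "fn F = (\<lambda>i h j. F $ eA i $ eK h $ eK j)" for F
  define bad where "bad = {(F, G). reducible CARD('a) CARD('k) CARD('r) (fn F) (fn G)}"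
  have neg: "negligible bad"
  proof (rule negligible_reducible[OF card])
    fix F G assume "(F, G) \<in> bad"
    then obtain X Y Z p q w where eq: "\<forall>i<CARD('a). \<forall>h<CARD('k). \<forall>j<CARD('k).
      fn F i h j + (\<Sum>i'<CARD('a). X i i' * fn G i' h j) + Y h j * (\<Sum>h'<CARD('k). fn F i h' j)
        + Z j h * (\<Sum>j'<CARD('k). fn F i h j') = (\<Sum>l<CARD('r). p l i * q l h * w l j)"
      unfolding bad_def reducible_def by auto
    have sums: "(\<Sum>i'\<in>UNIV. X (dA i) (dA i') * G $ i' $ h $ j)
          = (\<Sum>i'<CARD('a). X (dA i) i' * fn G i' (dK h) (dK j))"
      "(\<Sum>h'\<in>UNIV. F $ i $ h' $ j) = (\<Sum>h'<CARD('k). fn F (dA i) h' (dK j))"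
      "(\<Sum>j'\<in>UNIV. F $ i $ h $ j') = (\<Sum>j'<CARD('k). fn F (dA i) (dK h) j')"
      "(\<Sum>l\<in>UNIV. p (dR l) (dA i) * q (dR l) (dK h) * w (dR l) (dK j))
          = (\<Sum>l<CARD('r). p l (dA i) * q l (dK h) * w l (dK j))" for i h j
      unfolding sum.reindex_bij_betw[OF d(1), symmetric] sum.reindex_bij_betw[OF d(2), symmetric]
        sum.reindex_bij_betw[OF d(3), symmetric]
      by (simp_all add: fn_def ed)
    show "\<exists>(X :: complex ^ 'a ^ 'a) (Y :: complex ^ 'k ^ 'k) (Z :: complex ^ 'k ^ 'k)
        (p :: complex ^ 'a ^ 'r) (q :: complex ^ 'k ^ 'r) (w :: complex ^ 'k ^ 'r). \<forall>i h j.
        F $ i $ h $ j + (\<Sum>i'\<in>UNIV. X $ i $ i' * G $ i' $ h $ j)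
          + Y $ h $ j * (\<Sum>h'\<in>UNIV. F $ i $ h' $ j) + Z $ j $ h * (\<Sum>j'\<in>UNIV. F $ i $ h $ j')
        = (\<Sum>l\<in>UNIV. p $ l $ i * q $ l $ h * w $ l $ j)"
      by (rule exI[of _ "\<chi> i i'. X (dA i) (dA i')"], rule exI[of _ "\<chi> h j. Y (dK h) (dK j)"],
          rule exI[of _ "\<chi> j h. Z (dK j) (dK h)"], rule exI[of _ "\<chi> l i. p (dR l) (dA i)"],
          rule exI[of _ "\<chi> l h. q (dR l) (dK h)"], rule exI[of _ "\<chi> l j. w (dR l) (dK j)"])
        (use eq lt in \<open>simp add: sums eq[rule_format, symmetric], simp add: fn_def ed\<close>)
  qed
  define t :: "complex ^ 'k ^ 'k ^ 'a \<Rightarrow> complex ^ 'k ^ 'k ^ 'a" where "t F = (\<chi> i h j. F $ i $ j $ h)" for F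
  define \<sigma> where "\<sigma> = (\<lambda>(F, G). (t G, t F))"
  have "linear \<sigma>"
    by (rule linearI) (auto simp: \<sigma>_def t_def vec_eq_iff)
  then have "negligible (bad \<union> \<sigma> ` bad)"
    using neg by (intro negligible_Un negligible_differentiable_image_negligible
        linear_imp_differentiable_on) auto
  then obtain F G where FG: "(F, G) \<notin> bad" "(F, G) \<notin> \<sigma> ` bad"
    by (metis UNIV_eq_I UnI1 UnI2 non_negligible_UNIV surj_pair)
  \<comment> \<open>\<sigma> is an involution, so (F, G) outside \<sigma>(bad) means (t G, t F)
    outside bad.\<close>
  have "\<sigma> (t G, t F) = (F, G)"
    by (simp add: \<sigma>_def t_def vec_eq_iff)
  then have "(t G, t F) \<notin> bad"
    using FG(2) by (metis imageI)
  then have "\<not> reducible CARD('a) CARD('k) CARD('r) (\<lambda>i h j. fn G i j h) (\<lambda>i h j. fn F i j h)"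
    by (simp add: bad_def fn_def t_def)
  with FG(1) show ?thesis
    unfolding bad_def by blast
qed

section \<open>The tensor and its blocks\<close>

definition dir_vec :: "nat \<Rightarrow> nat \<Rightarrow> nat + nat \<Rightarrow> complex" where
  "dir_vec h j = case_sum (\<lambda>i. of_bool (i = h)) (\<lambda>i. of_bool (i = j))"

text \<open>The third factor exchanges h and j. Thus \<open>T_111\<close> and \<open>T_211\<close>
  read both indices, whereas \<open>T_121\<close> reads j twice and \<open>T_112\<close> reads h
  twice, which leaves a sum over the other index.\<close>

definition twisted_tensor :: "nat \<Rightarrow> nat \<Rightarrow> (nat \<Rightarrow> nat \<Rightarrow> nat \<Rightarrow> complex) \<Rightarrow> (nat \<Rightarrow> nat \<Rightarrow> nat \<Rightarrow> complex) \<Rightarrow>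
    nat + nat \<Rightarrow> nat + nat \<Rightarrow> nat + nat \<Rightarrow> complex" where
  "twisted_tensor n k f g = (\<lambda>x y z. \<Sum>(h, j)\<in>{..<k} \<times> {..<k}.
     case_sum (\<lambda>i. if i < n then f i h j else 0) (\<lambda>i. if i < n then g i h j else 0) x
     * dir_vec h j y * dir_vec j h z)"

lemma has_decomposition_twisted:
  "has_decomposition ({..<n} <+> {..<n}) ({..<k} <+> {..<k}) ({..<k} <+> {..<k}) (k * k)
     (twisted_tensor n k f g)"
proof -
  have "has_decomposition ({..<n} <+> {..<n}) ({..<k} <+> {..<k}) ({..<k} <+> {..<k})
     (card ({..<k} \<times> {..<k}))
     (\<lambda>x y z. \<Sum>l\<in>{..<k} \<times> {..<k}.
     case_sum (\<lambda>i. if i < n then f i (fst l) (snd l) else 0)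
              (\<lambda>i. if i < n then g i (fst l) (snd l) else 0) x
     * dir_vec (fst l) (snd l) y * dir_vec (snd l) (fst l) z)"
    by (intro has_decomposition_family)
      (auto simp: vec_space_def dir_vec_def Plus_def split: sum.splits)
  then show ?thesis
    by (simp add: twisted_tensor_def case_prod_beta)
qed

lemma twisted_in_tensor_space:
  "twisted_tensor n k f g \<in> tensor_space ({..<n} <+> {..<n}) ({..<k} <+> {..<k}) ({..<k} <+> {..<k})"
proof -
  have "twisted_tensor n k f g x y z = 0"
    if "(x, y, z) \<notin> ({..<n} <+> {..<n}) \<times> ({..<k} <+> {..<k}) \<times> ({..<k} <+> {..<k})" for x y z
    unfolding twisted_tensor_def
    by (rule sum.neutral) (use that in \<open>auto simp: dir_vec_def split: sum.splits\<close>)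
  then show ?thesis
    unfolding tensor_space_def by blast
qed

text \<open>The three index patterns are those of \<open>T_111\<close> and \<open>T_211\<close>, of
  \<open>T_112\<close>, and of \<open>T_121\<close>, in the shape that unfolding a block
  produces.\<close>

lemma sum_of_bool_pair:
  fixes F :: "nat \<Rightarrow> nat \<Rightarrow> complex"
  assumes "a < k" "b < k"
  shows "(\<Sum>(h, j)\<in>{..<k} \<times> {..<k}. F h j * of_bool (a = h) * of_bool (b = j)) = F a b"
    and "(\<Sum>(h, j)\<in>{..<k} \<times> {..<k}. F h j * of_bool (a = h) * of_bool (b = h))
           = of_bool (a = b) * (\<Sum>j<k. F a j)"
    and "(\<Sum>(h, j)\<in>{..<k} \<times> {..<k}. F h j * of_bool (a = j) * of_bool (b = j))
           = of_bool (a = b) * (\<Sum>h<k. F h a)"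
proof -
  have ob: "(\<Sum>j<k. x j * of_bool (c = j)) = x c" if "c < k" for x :: "nat \<Rightarrow> complex" and c
    using that by (simp add: of_bool_def if_distrib[of "\<lambda>y. _ * y"] cong: if_cong)
  show "(\<Sum>(h, j)\<in>{..<k} \<times> {..<k}. F h j * of_bool (a = h) * of_bool (b = j)) = F a b"
    unfolding sum.cartesian_product[symmetric] ob[OF assms(2)] ob[OF assms(1)] ..
  have "(\<Sum>(h, j)\<in>{..<k} \<times> {..<k}. F h j * of_bool (a = h) * of_bool (b = h))
      = (\<Sum>h<k. (\<Sum>j<k. F h j) * of_bool (b = h) * of_bool (a = h))"
    unfolding sum.cartesian_product[symmetric] by (simp only: sum_distrib_left sum_distrib_right mult_ac)
  then show "(\<Sum>(h, j)\<in>{..<k} \<times> {..<k}. F h j * of_bool (a = h) * of_bool (b = h))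
           = of_bool (a = b) * (\<Sum>j<k. F a j)"
    unfolding ob[OF assms(1)] by (simp add: mult_ac eq_commute)
  have "(\<Sum>(h, j)\<in>{..<k} \<times> {..<k}. F h j * of_bool (a = j) * of_bool (b = j))
      = (\<Sum>j<k. (\<Sum>h<k. F h j) * of_bool (b = j) * of_bool (a = j))"
    unfolding sum.cartesian_product[symmetric]
    by (subst sum.swap) (simp only: sum_distrib_left sum_distrib_right mult_ac)
  then show "(\<Sum>(h, j)\<in>{..<k} \<times> {..<k}. F h j * of_bool (a = j) * of_bool (b = j))
           = of_bool (a = b) * (\<Sum>h<k. F h a)"
    unfolding ob[OF assms(1)] by (simp add: mult_ac eq_commute)
qed

lemma block_twisted:
  assumes "i < n" "a < k" "b < k"
  shows "block (twisted_tensor n k f g) Inl Inl Inl i a b = f i a b"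
    and "block (twisted_tensor n k f g) Inr Inl Inl i a b = g i a b"
    and "block (twisted_tensor n k f g) Inl Inr Inl i a b = of_bool (a = b) * (\<Sum>h<k. f i h a)"
    and "block (twisted_tensor n k f g) Inl Inl Inr i a b = of_bool (a = b) * (\<Sum>j<k. f i a j)"
  unfolding block_def twisted_tensor_def dir_vec_def sum.case if_P[OF assms(1)]
    sum_of_bool_pair[OF assms(2,3)] by (rule refl)+

lemma block_twisted_in_tensor_space:
  assumes "\<And>i. F i \<in> {..<n} <+> {..<n} \<Longrightarrow> i < n"
    and "\<And>j. G j \<in> {..<k} <+> {..<k} \<Longrightarrow> j < k" and "\<And>j. H j \<in> {..<k} <+> {..<k} \<Longrightarrow> j < k"
  shows "block (twisted_tensor n k f g) F G H \<in> tensor_space {..<n} {..<k} {..<k}"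
  using twisted_in_tensor_space[of n k f g] assms unfolding tensor_space_def block_def by blast

lemma min_rank_mod_twisted:
  assumes "\<not> reducible n k r f g"
  shows "r < min_rank_mod {..<n} {..<k} {..<k} (block (twisted_tensor n k f g) Inl Inl Inl)
    (flat_A {..<n} (block (twisted_tensor n k f g) Inr Inl Inl))
    (flat_B {..<k} (block (twisted_tensor n k f g) Inl Inr Inl))
    (flat_C {..<k} (block (twisted_tensor n k f g) Inl Inl Inr))"
    (is "_ < min_rank_mod _ _ _ ?S (flat_A _ ?P) (flat_B _ ?Q) (flat_C _ ?R)")
proof (rule min_rank_mod_gtI)
  show "\<not> has_decomposition {..<n} {..<k} {..<k} r
    (\<lambda>i j k'. ?S i j k' + (\<Sum>i'\<in>{..<n}. X i i' * ?P i' j k') + (\<Sum>j'\<in>{..<k}. Y j j' * ?Q i j' k')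
      + (\<Sum>l\<in>{..<k}. Z k' l * ?R i j l))" (is "\<not> has_decomposition _ _ _ _ ?S'") for X Y Z
  proof
    assume "has_decomposition {..<n} {..<k} {..<k} r ?S'"
    then obtain p q w where eq: "?S' = (\<lambda>i h j. \<Sum>l<r. p l i * q l h * w l j)"
      unfolding has_decomposition_def by blast
    have "?S' i h j = f i h j + (\<Sum>i'<n. X i i' * g i' h j) + Y h j * (\<Sum>h'<k. f i h' j)
        + Z j h * (\<Sum>j'<k. f i h j')" if "i < n" "h < k" "j < k" for i h j
    proof -
      have "(\<Sum>i'<n. X i i' * ?P i' h j) = (\<Sum>i'<n. X i i' * g i' h j)"
        using that by (intro sum.cong) (simp_all add: block_twisted)
      moreover have "(\<Sum>j'<k. Y h j' * ?Q i j' j) = (\<Sum>j'<k. if j' = j then Y h j * (\<Sum>h'<k. f i h' j) else 0)"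
        using that by (intro sum.cong) (simp_all add: block_twisted)
      moreover have "(\<Sum>l<k. Z j l * ?R i h l) = (\<Sum>l<k. if l = h then Z j h * (\<Sum>j'<k. f i h j') else 0)"
        using that by (intro sum.cong) (simp_all add: block_twisted)
      ultimately show ?thesis
        using that by (simp add: block_twisted)
    qed
    moreover have "?S' i h j = (\<Sum>l<r. p l i * q l h * w l j)" for i h j
      by (rule fun_cong[OF fun_cong[OF fun_cong[OF eq]]])
    ultimately have "reducible n k r f g"
      unfolding reducible_def
      by (intro exI[of _ X] exI[of _ Y] exI[of _ Z] exI[of _ p] exI[of _ q] exI[of _ w]) simp
    with assms show False ..
  qed
qed (auto intro: block_twisted_in_tensor_space)

text \<open>Exchanging the summands turns \<open>dir_vec h j\<close> into
  \<open>dir_vec j h\<close>; renaming h and j in the sum restores the original form with f and g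
  exchanged and transposed. The bound for \<open>T_222\<close> thereby reduces to that for
  \<open>T_111\<close>.\<close>

lemma twisted_swap:
  "twisted_tensor n k f g (case_sum Inr Inl x) (case_sum Inr Inl y) (case_sum Inr Inl z)
     = twisted_tensor n k (\<lambda>i h j. g i j h) (\<lambda>i h j. f i j h) x y z"
proof -
  have "dir_vec h j (case_sum Inr Inl y) = dir_vec j h y" for h j y
    by (simp add: dir_vec_def split: sum.split)
  then show ?thesis
    unfolding twisted_tensor_def sum.cartesian_product[symmetric]
    by (subst sum.swap) (simp split: sum.split)
qed

theorem lemma3p2:
  "\<exists>(a\<^sub>1::nat) (a\<^sub>2::nat) (b\<^sub>1::nat) (b\<^sub>2::nat) (c\<^sub>1::nat) (c\<^sub>2::nat).
   \<exists>T \<in> tensor_space ({..<a\<^sub>1} <+> {..<a\<^sub>2}) ({..<b\<^sub>1} <+> {..<b\<^sub>2}) ({..<c\<^sub>1} <+> {..<c\<^sub>2}).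
     tensor_rank ({..<a\<^sub>1} <+> {..<a\<^sub>2}) ({..<b\<^sub>1} <+> {..<b\<^sub>2}) ({..<c\<^sub>1} <+> {..<c\<^sub>2}) T
     < min_rank_mod {..<a\<^sub>1} {..<b\<^sub>1} {..<c\<^sub>1} (block T Inl Inl Inl)
         (flat_A {..<a\<^sub>2} (block T Inr Inl Inl))
         (flat_B {..<b\<^sub>2} (block T Inl Inr Inl))
         (flat_C {..<c\<^sub>2} (block T Inl Inl Inr))
     + min_rank_mod {..<a\<^sub>2} {..<b\<^sub>2} {..<c\<^sub>2} (block T Inr Inr Inr)
         (flat_A {..<a\<^sub>1} (block T Inl Inr Inr))
         (flat_B {..<b\<^sub>1} (block T Inr Inl Inr))
         (flat_C {..<c\<^sub>1} (block T Inr Inr Inl))"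
proof -
  \<comment> \<open>Here r = k^2/2, so two ranks above r add up to more than k^2. With n = 4k the
    parameter count is 3 k^3 + 26 k^2, which must stay below 4 k^3; this means k > 26, and k = 32 is
    enough.\<close>
  obtain f g where
    irr\<^sub>1: "\<not> reducible 128 32 512 f g" and
    irr\<^sub>2: "\<not> reducible 128 32 512 (\<lambda>i h j. g i j h) (\<lambda>i h j. f i j h)"
    using generic_irreducible[where 'a = 128 and 'k = 32 and 'r = 512] by auto
  let ?T = "twisted_tensor 128 32 f g"
  let ?T' = "twisted_tensor 128 32 (\<lambda>i h j. g i j h) (\<lambda>i h j. f i j h)"
  have swap: "block ?T' Inl Inl Inl = block ?T Inr Inr Inr" "block ?T' Inr Inl Inl = block ?T Inl Inr Inr"
    "block ?T' Inl Inr Inl = block ?T Inr Inl Inr" "block ?T' Inl Inl Inr = block ?T Inr Inr Inl"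
    by (simp_all add: block_def twisted_swap[of 128 32 f g, symmetric])
  have "tensor_rank ({..<128} <+> {..<128}) ({..<32} <+> {..<32}) ({..<32} <+> {..<32}) ?T \<le> 1024"
    using tensor_rank_le[OF has_decomposition_twisted[of 128 32 f g]] by simp
  then show ?thesis
    using min_rank_mod_twisted[OF irr\<^sub>1] min_rank_mod_twisted[OF irr\<^sub>2, unfolded swap]
      twisted_in_tensor_space[of 128 32 f g]
    by (intro exI[of _ 128] exI[of _ 32] bexI[of _ ?T]) linarith+
qed

end
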